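(* Let $K$ be a field of characteristic zero, let $X=\{x_1,\ldots,x_d\}$ be a finite set, and let $u\in\langle X\rangle$ be a monomial of positive degree which is not a proper power of another monomial. Consider $K\langle X\rangle$ as a $K[u_1,u_2]$-module via $u_1w=uw$, $u_2w=wu$ for $w\in\langle X\rangle$. Then, as a $K[u_1,u_2]$-module, $K\langle X\rangle$ is a direct sum of submodules of the following three types: (i) $K[u]$; (ii) $K[u_1,u_2]t$ with $t\in\langle X\rangle$; (iii) $K[u_1,u_2]t_1+K[u_1,u_2]t_2$ with $t_1,t_2\in\langle X\rangle$, where: (i) $K[u]$ is generated as a $K[u_1,u_2]$-module by $1$, and $u^p=u_1^p\cdot 1$ for all $p\ge 0$. The defining relation of this submodule is $u_1\cdot 1=u_2\cdot 1$. (ii) $K[u_1,u_2]t$ is a free $K[u_1,u_2]$-module (with free generator $t$), and $u$ is neither a beginning nor a tail of $t$. If $t$ is a beginning (respectively, a tail) of $u$ and $t'$ is the tail (respectively, the beginning) of $u$ of the same degree as $t$, then $tu\neq ut'$ (respectively, $ut\neq t'u$). (iii) $t_1$ and $t_2$ are of the same degree and are, respectively, a proper beginning and a proper tail of $u$ such that $t_1u=ut_2$. The defining relation of this submodule (on the generators $t_1,t_2$) is $u_2t_1=u_1t_2$. There exist $v_1,v_2\in\langle X\rangle$ with $v_1v_2\neq v_2v_1$ and a positive integer $k$ such that \[ u=(v_1v_2)^kv_1,\quad t_1=v_1v_2,\quad t_2=v_2v_1. \]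
   Context: $\langle X\rangle$ denotes the free semigroup with unit (the set of all monomials, i.e. words, in $X$, including the empty word $1$), and $K\langle X\rangle$ is the free associative unital $K$-algebra generated by $X$, with $K$-basis $\langle X\rangle$. The degree of a monomial is its length. $K[u]$ is the subalgebra of $K\langle X\rangle$ generated by $u$. $K[u_1,u_2]$ is the commutative polynomial algebra in two variables; it acts on $K\langle X\rangle$ $K$-linearly with $u_1$ acting as left multiplication by $u$ and $u_2$ as right multiplication by $u$ (equivalently, $K\langle X\rangle$ is viewed as a $K[u]$-bimodule). For $v_1,v_2\in\langle X\rangle$, $v_1$ is a beginning of $v_2$ if $v_2=v_1w$ for some $w\in\langle X\rangle$, and a tail of $v_2$ if $v_2=wv_1$ for some $w\in\langle X\rangle$; a proper beginning or tail of $u$ has degree smaller than $\deg(u)$. "The defining relation" of a submodule with given generators means that all $K[u_1,u_2]$-linear relations between the generators are consequences of (i.e. generated by) that relation. In the direct sum there may be any number of summands of types (ii) and (iii), with varying $t$ and $(t_1,t_2)$. *)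

theory Defs
  imports Complex_Main "HOL-Library.Poly_Mapping" "HOL-Library.Product_Plus" "HOL-Library.Sublist"
begin

section \<open>The free associative algebra\<close>

text \<open>
  A monomial is a word, i.e. a list of variables; its degree is the length of the list.
  Making lists an additive monoid (under concatenation) turns the finitely supported functions
  \<^typ>\<open>'x list \<Rightarrow>\<^sub>0 'k\<close>, with the library's convolution product, into the free
  associative unital algebra on \<^typ>\<open>'x\<close>.
\<close>

instantiation list :: (type) monoid_add
begin

definition zero_list :: "'a list" where "zero_list = []"

definition plus_list :: "'a list \<Rightarrow> 'a list \<Rightarrow> 'a list" where "plus_list = (@)"

instance by standard (simp_all add: zero_list_def plus_list_def)

end

type_synonym ('x, 'k) free_algebra = "'x list \<Rightarrow>\<^sub>0 'k"

definition mon :: "'x list \<Rightarrow> ('x, 'k::field) free_algebra" where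
  "mon w = Poly_Mapping.single w 1"

definition word_power :: "'x list \<Rightarrow> nat \<Rightarrow> 'x list" where
  "word_power w k = concat (replicate k w)"

definition const :: "'k \<Rightarrow> ('x, 'k::field) free_algebra" where
  "const c = Poly_Mapping.single [] c"

definition subalgebra :: "('x, 'k::field) free_algebra set \<Rightarrow> bool" where
  "subalgebra A \<longleftrightarrow> 1 \<in> A \<and> (\<forall>c. \<forall>f\<in>A. const c * f \<in> A)
     \<and> (\<forall>f\<in>A. \<forall>g\<in>A. f + g \<in> A) \<and> (\<forall>f\<in>A. \<forall>g\<in>A. f * g \<in> A)"

abbreviation generated_subalgebra :: "('x, 'k::field) free_algebra \<Rightarrow> ('x, 'k) free_algebra set" where
  "generated_subalgebra f \<equiv> subalgebra hull {f}"


section \<open>The bimodule structure\<close>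

text \<open>The key \<^term>\<open>(a, b)\<close> stands for the commutative monomial \<open>u\<^sub>1\<^sup>a u\<^sub>2\<^sup>b\<close>.\<close>

type_synonym 'k poly2 = "nat \<times> nat \<Rightarrow>\<^sub>0 'k"

definition U1 :: "'k::field poly2" where "U1 = Poly_Mapping.single (1, 0) 1"

definition U2 :: "'k::field poly2" where "U2 = Poly_Mapping.single (0, 1) 1"

text \<open>
  \<open>u\<^sub>1\<^sup>a u\<^sub>2\<^sup>b\<close> sends \<open>f\<close> to \<open>u\<^sup>a f u\<^sup>b\<close>, extended \<open>K\<close>-linearly;
  see \<open>act_U1\<close>, \<open>act_U2\<close> and \<open>module_act\<close> below.
\<close>

definition act :: "'x list \<Rightarrow> 'k::field poly2 \<Rightarrow> ('x, 'k) free_algebra \<Rightarrow> ('x, 'k) free_algebra" where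
  "act u p f = (\<Sum>(a, b)\<in>Poly_Mapping.keys p.
     const (Poly_Mapping.lookup p (a, b)) * mon u ^ a * f * mon u ^ b)"

lemma poly_mapping_single_sum_induct [case_names single sum]:
  fixes p :: "'a \<Rightarrow>\<^sub>0 'b::comm_monoid_add"
  assumes single: "\<And>k c. P (Poly_Mapping.single k c)"
    and sum: "\<And>p q. P p \<Longrightarrow> P q \<Longrightarrow> P (p + q)"
  shows "P p"
proof (induction p rule: update_induct)
  case const
  then show ?case
    using single[of undefined 0] by simp
next
  case (update p k c)
  have "Poly_Mapping.update k c p = p + Poly_Mapping.single k c"
    by (rule poly_mapping_eqI)
      (use update.hyps in \<open>auto simp: lookup_update lookup_add lookup_single in_keys_iff when_def\<close>)
  then show ?case
    using sum[OF update.IH single] by simp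
qed

lemma mon_Nil: "mon [] = 1"
  by (simp add: mon_def flip: zero_list_def)

lemma mon_append: "mon (v @ w) = mon v * mon w"
  by (simp add: mon_def mult_single plus_list_def)

lemma act_superset:
  assumes "finite S" "Poly_Mapping.keys p \<subseteq> S"
  shows "act u p f = (\<Sum>(a, b)\<in>S.
     const (Poly_Mapping.lookup p (a, b)) * mon u ^ a * f * mon u ^ b)"
  unfolding act_def
  by (rule sum.mono_neutral_left)
    (use assms in \<open>auto simp: const_def in_keys_iff\<close>)

lemma act_single: "act u (Poly_Mapping.single (a, b) c) f = const c * mon u ^ a * f * mon u ^ b"
  by (subst act_superset[where S = "{(a, b)}"]) auto

lemma act_U1: "act u U1 f = mon u * f"
  by (simp add: U1_def act_single const_def flip: zero_list_def)

lemma act_U2: "act u U2 f = f * mon u"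
  by (simp add: U2_def act_single const_def flip: zero_list_def)

lemma act_add_left: "act u (p + q) f = act u p f + act u q f"
proof -
  let ?S = "Poly_Mapping.keys p \<union> Poly_Mapping.keys q"
  have "Poly_Mapping.keys (p + q) \<subseteq> ?S"
    by (rule Poly_Mapping.keys_add)
  then show ?thesis
    by (subst (1 2 3) act_superset[of ?S])
      (auto simp: lookup_add const_def single_add distrib_right sum.distrib case_prod_beta)
qed

lemma const_commute: "const c * f = f * const c"
  for f :: "('x, 'k::field) free_algebra"
proof (induction f rule: poly_mapping_single_sum_induct)
  case (single k v)
  then show ?case
    by (simp add: const_def mult_single plus_list_def mult.commute)
next
  case (sum f g)
  then show ?case
    by (simp add: distrib_left distrib_right)
qed

lemma const_mult: "const (c * d) = const c * const d"
  by (simp add: const_def mult_single plus_list_def)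

lemma act_add_right: "act u p (f + g) = act u p f + act u p g"
  by (simp add: act_def distrib_left distrib_right sum.distrib case_prod_beta)

lemma act_mult: "act u (p * q) f = act u p (act u q f)"
proof (induction p rule: poly_mapping_single_sum_induct)
  case (single k c)
  obtain a b where k: "k = (a, b)" by force
  show ?case
  proof (induction q rule: poly_mapping_single_sum_induct)
    case (single l d)
    obtain a' b' where l: "l = (a', b')" by force
    have "const (c * d) * mon u ^ (a + a') * f * mon u ^ (b + b')
        = const c * (const d * mon u ^ a) * mon u ^ a' * f * mon u ^ b' * mon u ^ b"
      by (simp add: const_mult power_add mult.assoc flip: power_add)
        (simp add: add.commute)
    also have "\<dots> = const c * mon u ^ a * (const d * mon u ^ a' * f * mon u ^ b') * mon u ^ b"
      by (subst const_commute) (simp add: mult.assoc)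
    finally show ?case
      by (simp add: k l mult_single act_single)
  next
    case (sum q r)
    then show ?case
      by (simp add: distrib_left act_add_left act_add_right)
  qed
next
  case (sum p q)
  then show ?case
    by (simp add: distrib_right act_add_left)
qed

lemma module_act: "module (act u :: 'k::field poly2 \<Rightarrow> ('x, 'k) free_algebra \<Rightarrow> _)"
proof
  fix f :: "('x, 'k) free_algebra"
  have "act u (Poly_Mapping.single (0, 0) 1) f = f"
    by (simp only: act_single) (simp add: const_def flip: zero_list_def)
  then show "act u 1 f = f"
    by (simp flip: zero_prod_def)
qed (simp_all add: act_add_left act_add_right act_mult)

abbreviation cyclic :: "'x list \<Rightarrow> ('x, 'k::field) free_algebra \<Rightarrow> ('x, 'k) free_algebra set" where
  "cyclic u f \<equiv> module.span (act u) {f}"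


section \<open>Defining relations and direct sums\<close>

text \<open>
  A relation between generators is encoded by its coefficients. It is \<^emph>\<open>the\<close> defining relation
  if the module of all relations is the submodule that it generates.
\<close>

definition defining_relation1 ::
    "('r::comm_ring_1 \<Rightarrow> 'm::ab_group_add \<Rightarrow> 'm) \<Rightarrow> 'm \<Rightarrow> 'r \<Rightarrow> bool" where
  "defining_relation1 scale g r \<longleftrightarrow> {p. scale p g = 0} = module.span times {r}"

definition scale2 :: "'r::comm_ring_1 \<Rightarrow> 'r \<times> 'r \<Rightarrow> 'r \<times> 'r" where
  "scale2 c = (\<lambda>(p, q). (c * p, c * q))"

definition defining_relation2 ::
    "('r::comm_ring_1 \<Rightarrow> 'm::ab_group_add \<Rightarrow> 'm) \<Rightarrow> 'm \<Rightarrow> 'm \<Rightarrow> 'r \<times> 'r \<Rightarrow> bool" where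
  "defining_relation2 scale g h r \<longleftrightarrow>
     {(p, q). scale p g + scale q h = 0} = module.span scale2 {r}"

lemma module_mult_self: "module (times :: 'r::comm_ring_1 \<Rightarrow> 'r \<Rightarrow> 'r)"
  by standard (simp_all add: algebra_simps)

lemma module_scale2: "module (scale2 :: 'r::comm_ring_1 \<Rightarrow> _)"
  by standard (auto simp: scale2_def algebra_simps)

text \<open>
  Internal direct sum: each element is in a unique way the sum of a finitely supported family
  \<open>f\<close> with \<open>f i \<in> M i\<close>; the value \<open>0\<close> of \<open>f\<close> outside \<open>I\<close> is a normalisation.
\<close>

definition is_direct_sum ::
    "('r::comm_ring_1 \<Rightarrow> 'm::ab_group_add \<Rightarrow> 'm) \<Rightarrow> 'i set \<Rightarrow> ('i \<Rightarrow> 'm set) \<Rightarrow> bool" where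
  "is_direct_sum scale I M \<longleftrightarrow>
     (\<forall>i\<in>I. module.subspace scale (M i)) \<and>
     (\<forall>v. \<exists>!f. (\<forall>i. i \<notin> I \<longrightarrow> f i = 0) \<and> (\<forall>i\<in>I. f i \<in> M i) \<and>
               finite {i. f i \<noteq> 0} \<and> v = (\<Sum>i | f i \<noteq> 0. f i))"

datatype 'x label = Powers | Free "'x list" | Paired "'x list" "'x list"

fun summand :: "'x list \<Rightarrow> 'x label \<Rightarrow> ('x, 'k::field) free_algebra set" where
  "summand u Powers = generated_subalgebra (mon u)"
| "summand u (Free t) = cyclic u (mon t)"
| "summand u (Paired t1 t2) = {f + g | f g. f \<in> cyclic u (mon t1) \<and> g \<in> cyclic u (mon t2)}"

end

theory Submission
  imports Defs
begin

text \<open>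
  Multiplying by \<open>u\<close> on either side takes words to words, so the theorem is about words
  and not about coefficients. If the words fall into disjoint classes, each closed under both
  multiplications, then the algebra is the direct sum of the subspaces spanned by the classes
  (\<open>is_direct_sum_partition\<close>), and each of these is a submodule.

  To find the classes, strip copies of \<open>u\<close> from both ends of a word until none is left: every word is
  \<open>u\<^sup>a s u\<^sup>b\<close> with a \<open>core\<close> \<open>s\<close>, which has \<open>u\<close> neither as a prefix nor as a suffix. The order of
  stripping may matter, as \<open>u\<close> can overlap itself. When it does, cancellation leaves an equation
  \<open>s u\<^sup>e = u\<^sup>e t\<close> with \<open>e > 0\<close> between cores, which are then shorter than \<open>u\<close>. For \<open>e > 1\<close> this would
  make \<open>s\<close> commute with \<open>u\<close>, and since \<open>u\<close> is primitive, \<open>s\<close> and \<open>t\<close> would be empty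
  (\<open>shift_past_square\<close>). So there are only three possibilities (\<open>sandwich_core_eq\<close>): the
  representations agree, the core is empty, or \<open>s u = u t\<close> and one copy of \<open>u\<close> has changed sides.
  They give the three types of summands. The empty core yields the powers of \<open>u\<close>. A nonempty core that
  takes part in no equation \<open>s u = u t\<close> yields a free summand. The remaining cores occur in disjoint
  pairs \<open>(t\<^sub>1, t\<^sub>2)\<close> with \<open>t\<^sub>1 u = u t\<^sub>2\<close>, a chain \<open>t\<^sub>1 u = u t\<^sub>2\<close>, \<open>t\<^sub>2 u = u t\<^sub>3\<close> being again excluded by
  \<open>shift_past_square\<close>. The shape of such pairs is the classical description of conjugate words
  (\<open>conjugate_words\<close>).

  The defining relations follow by reduction to normal form. The given relation reduces
  any relation to one whose terms go to pairwise distinct words, so all its coefficients vanish.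
\<close>

section \<open>Powers, commutation and conjugacy of words\<close>

lemma word_power_0 [simp]: "word_power u 0 = []"
  by (simp add: word_power_def)

lemma word_power_Suc: "word_power u (Suc n) = u @ word_power u n"
  by (simp add: word_power_def)

lemma word_power_add: "word_power u (m + n) = word_power u m @ word_power u n"
  by (simp add: word_power_def replicate_add)

lemma word_power_Suc_right: "word_power u (Suc n) = word_power u n @ u"
  using word_power_add[of u n 1] by (simp add: word_power_def)

lemma length_word_power [simp]: "length (word_power u n) = n * length u"
  by (induction n) (simp_all add: word_power_Suc)

lemma mon_word_power: "mon (word_power u n) = mon u ^ n"
  by (induction n) (simp_all add: mon_Nil word_power_Suc mon_append)

definition primitive_word :: "'x list \<Rightarrow> bool" where
  "primitive_word u \<longleftrightarrow> u \<noteq> [] \<and> \<not> (\<exists>w k. k \<ge> 2 \<and> u = word_power w k)"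

lemma commuting_with_primitive_shorter:
  assumes "primitive_word u" "s @ u = u @ s" "length s < length u"
  shows "s = []"
proof -
  obtain m n z where z: "word_power z m = s" "word_power z n = u"
    using comm_append_are_replicate[OF assms(2)] unfolding word_power_def by blast
  from assms(1) have "n \<noteq> 0" "\<not> n \<ge> 2"
    using z(2) by (auto simp: primitive_word_def intro: gr0I)
  then have "n = 1" by linarith
  then have "u = z" using z(2) by (simp add: word_power_Suc)
  then have "m = 0" using z(1) assms(3) by (cases m) (auto simp: word_power_Suc)
  then show ?thesis using z(1) by simp
qed

text \<open>
  As \<open>s\<close> is shorter than \<open>u\<close>, the equation makes it a prefix of \<open>u\<close>. The first \<open>|s| + |u|\<close> letters
  of the right-hand side lie in \<open>u u\<close>, and since the second copy of \<open>u\<close> also starts with \<open>s\<close>, they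
  spell \<open>u s\<close>. On the left-hand side they spell \<open>s u\<close>.
\<close>

lemma shift_past_square:
  assumes "primitive_word u" "length s < length u" "s @ u @ u @ x = u @ u @ y"
  shows "s = []"
proof -
  have "prefix u (s @ u @ u @ x)"
    using assms(3) by (auto intro: prefixI)
  then have "prefix s u"
    using assms(2) by (intro prefix_length_prefix[of s "s @ u @ u @ x" u]) auto
  then obtain r where r: "u = s @ r" by (auto simp: prefix_def)
  have "(s @ u) @ (u @ x) = u @ u @ y" using assms(3) by simp
  also have "\<dots> = (u @ s) @ (r @ y)" by (subst (2) r) simp
  finally have "s @ u = u @ s"
    by (subst (asm) append_eq_append_conv) auto
  then show ?thesis
    using assms(1,2) commuting_with_primitive_shorter by blast
qed

text \<open>
  Cancelling a prefix \<open>t\<^sub>1\<close> of \<open>u\<close> preserves the equation and shortens \<open>u\<close>. When \<open>u\<close> has become a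
  prefix of \<open>t\<^sub>1\<close>, it serves as \<open>v\<^sub>1\<close>.
\<close>

lemma conjugate_words:
  assumes "t1 @ u = u @ t2" "t1 \<noteq> []"
  shows "\<exists>v1 v2 k. u = word_power (v1 @ v2) k @ v1 \<and> t1 = v1 @ v2 \<and> t2 = v2 @ v1"
  using assms
proof (induction u rule: length_induct)
  case (1 u)
  consider v where "t1 = u @ v" "t2 = v @ u" | u' where "u = t1 @ u'" "u = u' @ t2"
    using iffD1[OF append_eq_append_conv2 "1.prems"(1)] by blast
  then show ?case
  proof cases
    case 1
    then show ?thesis
      by (intro exI[of _ u] exI[of _ v] exI[of _ 0]) simp
  next
    case 2
    have "t1 @ u' = u' @ t2" using 2 by (rule subst)
    moreover have "length u' < length u"
      using "1.prems"(2) by (simp add: 2(1))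
    ultimately obtain v1 v2 k
      where v: "u' = word_power (v1 @ v2) k @ v1" "t1 = v1 @ v2" "t2 = v2 @ v1"
      using "1.IH" "1.prems"(2) by blast
    have "u = word_power (v1 @ v2) (Suc k) @ v1"
      unfolding word_power_Suc 2(1) v(1,2) by simp
    with v(2,3) show ?thesis by blast
  qed
qed


section \<open>Stripping copies of \<open>u\<close> from both ends of a word\<close>

definition sandwich :: "'x list \<Rightarrow> 'x list \<Rightarrow> nat \<times> nat \<Rightarrow> 'x list" where
  "sandwich u t = (\<lambda>(a, b). word_power u a @ t @ word_power u b)"

definition core :: "'x list \<Rightarrow> 'x list \<Rightarrow> bool" where
  "core u s \<longleftrightarrow> \<not> prefix u s \<and> \<not> suffix u s"

definition paired_cores :: "'x list \<Rightarrow> ('x list \<times> 'x list) set" where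
  "paired_cores u = {(t1, t2). t1 \<noteq> [] \<and> length t1 < length u \<and> t1 @ u = u @ t2}"

text \<open>
  Taking \<open>t'\<close> empty shows that the empty word, which is the core of the powers of \<open>u\<close>, is not a free
  core.
\<close>

definition free_cores :: "'x list \<Rightarrow> 'x list set" where
  "free_cores u = {t. core u t \<and> (\<forall>t'. t @ u \<noteq> u @ t') \<and> (\<forall>t'. u @ t \<noteq> t' @ u)}"

lemma core_short: "length s < length u \<Longrightarrow> core u s"
  by (auto simp: core_def dest: prefix_length_le suffix_length_le)

lemma core_shift_left:
  assumes "core u s" "s @ x = u @ y"
  shows "length s < length u"
proof (rule ccontr)
  assume "\<not> length s < length u"
  moreover have "prefix u (s @ x)" using assms(2) by (auto intro: prefixI)
  ultimately have "prefix u s" by (intro prefix_length_prefix[of u "s @ x" s]) auto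
  then show False using assms(1) by (simp add: core_def)
qed

lemma core_shift_right:
  assumes "core u s" "x @ s = y @ u"
  shows "length s < length u"
proof (rule ccontr)
  assume "\<not> length s < length u"
  moreover have "suffix u (x @ s)" using assms(2) by (auto intro: suffixI)
  ultimately have "suffix u s" by (intro suffix_length_suffix[of u "x @ s" s]) (auto simp: suffix_def)
  then show False using assms(1) by (simp add: core_def)
qed

lemma paired_coresD:
  assumes "(t1, t2) \<in> paired_cores u"
  shows "t1 \<noteq> []" "length t1 < length u" "t1 @ u = u @ t2" "length t1 = length t2" "t2 \<noteq> []"
proof -
  show t: "t1 \<noteq> []" "length t1 < length u" "t1 @ u = u @ t2"
    using assms unfolding paired_cores_def by blast+
  show "length t1 = length t2"
    using arg_cong[OF t(3), of length] unfolding length_append by linarith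
  with t(1) show "t2 \<noteq> []" by fastforce
qed

lemma paired_cores_core:
  assumes "(t1, t2) \<in> paired_cores u"
  shows "core u t1" "core u t2"
  using paired_coresD[OF assms] by (intro core_short; linarith)+

lemma paired_cores_unique_right:
  "(t, t1) \<in> paired_cores u \<Longrightarrow> (t, t2) \<in> paired_cores u \<Longrightarrow> t1 = t2"
  by (simp add: paired_cores_def)

lemma paired_cores_unique_left:
  "(t1, t) \<in> paired_cores u \<Longrightarrow> (t2, t) \<in> paired_cores u \<Longrightarrow> t1 = t2"
  by (auto simp: paired_cores_def) (metis append_same_eq)

text \<open>
  A chain would shift \<open>t\<^sub>1\<close> past \<open>u u\<close>. The case \<open>t\<^sub>1 = t\<^sub>2 = t\<^sub>3\<close> shows that no core is paired with
  itself.
\<close>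

lemma paired_cores_no_chain:
  assumes "primitive_word u" "(t1, t2) \<in> paired_cores u" "(t2, t3) \<in> paired_cores u"
  shows False
proof -
  have t: "t1 @ u = u @ t2" "t2 @ u = u @ t3" "length t1 < length u"
    using assms(2,3) paired_coresD by blast+
  have "t1 @ u @ u @ [] = (t1 @ u) @ u" by simp
  also have "\<dots> = u @ t2 @ u" using t(1) by simp
  also have "\<dots> = u @ u @ t3" using t(2) by simp
  finally have "t1 = []"
    by (rule shift_past_square[OF assms(1) t(3)])
  then show False
    using paired_coresD(1)[OF assms(2)] by blast
qed

lemma free_cores_not_paired:
  assumes "t \<in> free_cores u"
  shows "(t, s) \<notin> paired_cores u" "(s, t) \<notin> paired_cores u" "t \<noteq> []"
  using assms by (auto simp: free_cores_def paired_cores_def) metis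

lemma sandwich_core_exists:
  assumes "u \<noteq> []"
  shows "\<exists>s ab. core u s \<and> w = sandwich u s ab"
proof (induction w rule: length_induct)
  case (1 w)
  consider "core u w" | w' where "w = u @ w'" | w' where "w = w' @ u"
    by (auto simp: core_def prefix_def suffix_def)
  then show ?case
  proof cases
    case 1
    then show ?thesis
      by (intro exI[of _ w] exI[of _ "(0, 0)"]) (simp add: sandwich_def)
  next
    case 2
    then have "length w' < length w" using assms by simp
    with "1.IH" obtain s a b where "core u s" "w' = sandwich u s (a, b)"
      by (metis surj_pair)
    with 2 show ?thesis
      by (intro exI[of _ s] exI[of _ "(Suc a, b)"]) (simp add: sandwich_def word_power_Suc)
  next
    case 3
    then have "length w' < length w" using assms by simp
    with "1.IH" obtain s a b where "core u s" "w' = sandwich u s (a, b)"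
      by (metis surj_pair)
    with 3 show ?thesis
      by (intro exI[of _ s] exI[of _ "(a, Suc b)"]) (simp add: sandwich_def word_power_Suc_right)
  qed
qed

text \<open>
  Unless the powers are trivial, both cores are shorter than \<open>u\<close>, because otherwise one of the outer
  copies of \<open>u\<close> would lie inside a core. Comparing lengths modulo \<open>|u|\<close> gives \<open>|s| = |t|\<close>, hence
  \<open>e = f\<close>. If the common exponent exceeds 1, then \<open>s\<close> is shifted past a square and must be empty.
\<close>

lemma shifted_cores:
  assumes u: "primitive_word u" and st: "core u s" "core u t"
    and eq: "s @ word_power u f = word_power u e @ t"
  shows "e = f \<and> (s = t \<and> (f = 0 \<or> s = []) \<or> f = 1 \<and> (s, t) \<in> paired_cores u)"
proof -
  have "e = 0 \<longleftrightarrow> f = 0"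
  proof
    assume "e = 0"
    then have "t = s @ word_power u f" using eq by simp
    then show "f = 0"
      using st(2) by (cases f) (auto simp: core_def suffix_def word_power_Suc_right)
  next
    assume "f = 0"
    then show "e = 0"
      using eq st(1) by (cases e) (auto simp: core_def prefix_def word_power_Suc)
  qed
  moreover have ?thesis if "e = Suc e'" "f = Suc f'" for e' f'
  proof -
    have "s @ u @ word_power u f' = u @ word_power u e' @ t"
      using eq that by (simp add: word_power_Suc)
    then have s: "length s < length u" by (rule core_shift_left[OF st(1)])
    have "(s @ word_power u f') @ u = word_power u e @ t"
      using eq that(2) by (simp add: word_power_Suc_right)
    then have t: "length t < length u"
      by (intro core_shift_right[OF st(2)]) (rule sym)
    have len: "length s + f * length u = length t + e * length u"
      using arg_cong[OF eq, of length] by simp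
    then have "(length s + f * length u) mod length u = (length t + e * length u) mod length u"
      by (rule arg_cong)
    then have lst: "length s = length t" using s t by simp
    then have ef: "e = f" using len u by (simp add: primitive_word_def)
    show ?thesis
    proof (cases f')
      case 0
      have one: "e = 1" "f = 1" using 0 that ef by auto
      then have "s @ u = u @ t" using eq by (simp add: word_power_Suc)
      then have "s = [] \<or> (s, t) \<in> paired_cores u"
        using s unfolding paired_cores_def by blast
      then show ?thesis using one lst by auto
    next
      case (Suc g)
      then have "e = Suc (Suc g)" "f = Suc (Suc g)" using that ef by auto
      then have "s @ u @ u @ word_power u g = u @ u @ word_power u g @ t"
        using eq by (simp add: word_power_Suc)
      then have "s = []" by (rule shift_past_square[OF u s])
      moreover from this have "t = []" using lst by simp
      ultimately show ?thesis using ef by blast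
    qed
  qed
  moreover have ?thesis if "e = 0" "f = 0"
    using eq that by simp
  ultimately show ?thesis
    by (metis old.nat.exhaust)
qed

text \<open>
  Cancel the common copies of \<open>u\<close> on both sides. If all remaining copies are on one side of the equation,
  there are none, by the definition of a core. Otherwise they stand on opposite ends, as in
  \<open>shifted_cores\<close>. The assumption \<open>a \<le> c\<close>, which fixes which of the two words is called \<open>s\<close>, leaves
  only one orientation of the pair.
\<close>

lemma sandwich_core_eq:
  assumes u: "primitive_word u" and st: "core u s" "core u t"
    and eq: "sandwich u s (a, b) = sandwich u t (c, d)" and le: "a \<le> c"
  shows "s = t \<and> (a, b) = (c, d) \<or> s = [] \<and> t = [] \<or>
    (s, t) \<in> paired_cores u \<and> c = Suc a \<and> b = Suc d"
proof -
  obtain e where e: "c = a + e" using le by (auto simp: le_iff_add)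
  have eq1: "s @ word_power u b = word_power u e @ t @ word_power u d"
    using eq by (simp add: sandwich_def e word_power_add)
  show ?thesis
  proof (cases "b \<le> d")
    case True
    then obtain f where f: "d = f + b" by (metis add.commute le_iff_add)
    have "s @ word_power u b = (word_power u e @ t @ word_power u f) @ word_power u b"
      unfolding eq1 by (simp add: f word_power_add)
    then have s: "s = word_power u e @ t @ word_power u f"
      unfolding append_same_eq .
    have "e = 0"
    proof (cases e)
      case (Suc e')
      then have "prefix u s" unfolding s by (simp add: word_power_Suc)
      with st(1) show ?thesis by (simp add: core_def)
    qed
    moreover have "f = 0"
    proof (cases f)
      case (Suc f')
      then have "suffix u s" unfolding s by (simp add: word_power_Suc_right suffix_def)
      with st(1) show ?thesis by (simp add: core_def)
    qed
    ultimately show ?thesis using s e f by simp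
  next
    case False
    then obtain f where f: "b = f + d" "f > 0"
      by (metis add.commute less_imp_add_positive not_le)
    have "(s @ word_power u f) @ word_power u d = (word_power u e @ t) @ word_power u d"
      using eq1 unfolding f(1) word_power_add append_assoc .
    then have "s @ word_power u f = word_power u e @ t"
      unfolding append_same_eq .
    from shifted_cores[OF u st this] show ?thesis
      using e f by auto
  qed
qed

lemma sandwich_inj:
  assumes u: "primitive_word u" and t: "core u t" "t \<noteq> []"
  shows "inj (sandwich u t)"
proof -
  have "(t, t) \<notin> paired_cores u"
    using paired_cores_no_chain[OF u] by blast
  then have *: "(a, b) = (c, d)" if "sandwich u t (a, b) = sandwich u t (c, d)" "a \<le> c" for a b c d
    using sandwich_core_eq[OF u t(1) t(1) that] t(2) by blast
  show ?thesis
  proof (rule injI, clarify)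
    fix a b c d assume eq: "sandwich u t (a, b) = sandwich u t (c, d)"
    show "a = c \<and> b = d"
      using *[OF eq] *[OF eq[symmetric]] by (cases "a \<le> c") auto
  qed
qed

lemma cores_of_sandwich_unique:
  assumes u: "primitive_word u" and st: "core u s" "core u t"
    and eq: "sandwich u s x = sandwich u t y"
  shows "s = t \<or> (s, t) \<in> paired_cores u \<or> (t, s) \<in> paired_cores u"
proof -
  obtain a b c d where xy: "x = (a, b)" "y = (c, d)" by fastforce
  show ?thesis
    using sandwich_core_eq[OF u st eq[unfolded xy]]
      sandwich_core_eq[OF u st(2,1) eq[unfolded xy, symmetric]]
    by (cases "a \<le> c") auto
qed

lemma core_cases:
  assumes "core u s"
  obtains "s = []" | "s \<in> free_cores u"
    | t where "(s, t) \<in> paired_cores u" | t where "(t, s) \<in> paired_cores u"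
proof (cases "s = [] \<or> s \<in> free_cores u")
  case False
  then consider t where "s @ u = u @ t" | t where "u @ s = t @ u"
    using assms by (auto simp: free_cores_def)
  then show ?thesis
  proof cases
    case 1
    then have "length s < length u"
      by (rule core_shift_left[OF assms])
    with 1 False that(3) show ?thesis by (auto simp: paired_cores_def)
  next
    case 2
    have "length s < length u"
      using core_shift_right[OF assms 2] .
    moreover have "length t = length s" using arg_cong[OF 2, of length] by simp
    ultimately have "(t, s) \<in> paired_cores u"
      using 2 False by (auto simp: paired_cores_def)
    then show ?thesis by (rule that(4))
  qed
qed (use that in auto)

fun component :: "'x list \<Rightarrow> 'x label \<Rightarrow> 'x list set" where
  "component u Powers = range (sandwich u [])"
| "component u (Free t) = range (sandwich u t)"
| "component u (Paired t1 t2) = range (sandwich u t1) \<union> range (sandwich u t2)"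

definition labels :: "'x list \<Rightarrow> 'x label set" where
  "labels u = {Powers} \<union> Free ` free_cores u \<union> {Paired t1 t2 | t1 t2. (t1, t2) \<in> paired_cores u}"

lemma components_cover:
  assumes "u \<noteq> []"
  shows "\<exists>i\<in>labels u. w \<in> component u i"
proof -
  obtain s ab where s: "core u s" and w: "w = sandwich u s ab"
    using sandwich_core_exists[OF assms] by blast
  from s show ?thesis
  proof (cases rule: core_cases)
    case 1 then show ?thesis using w by (intro bexI[of _ Powers]) (auto simp: labels_def)
  next
    case 2 then show ?thesis using w by (intro bexI[of _ "Free s"]) (auto simp: labels_def)
  next
    case (3 t) then show ?thesis
      using w by (intro bexI[of _ "Paired s t"]) (auto simp: labels_def)
  next
    case (4 t) then show ?thesis
      using w by (intro bexI[of _ "Paired t s"]) (auto simp: labels_def)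
  qed
qed

fun label_cores :: "'x label \<Rightarrow> 'x list set" where
  "label_cores Powers = {[]}"
| "label_cores (Free t) = {t}"
| "label_cores (Paired t1 t2) = {t1, t2}"

lemma component_label_cores: "component u i = (\<Union>s\<in>label_cores i. range (sandwich u s))"
  by (cases i) auto

text \<open>
  The summand of a core is determined because the empty core, the free cores, the left members
  and the right members of pairs form disjoint sets, and each member of a pair determines the other.
\<close>

lemma label_of_core_unique:
  assumes u: "primitive_word u" and "i \<in> labels u" "j \<in> labels u"
    and "s \<in> label_cores i" "s \<in> label_cores j"
  shows "i = j"
proof -
  have nil: "([], t) \<notin> paired_cores u" "(t, []) \<notin> paired_cores u" for t
    using paired_coresD(1,5) by blast+
  show ?thesis
    using assms(2-)
    by (cases i; cases j)
      (auto simp: labels_def nil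
        dest: free_cores_not_paired paired_cores_no_chain[OF u]
          paired_cores_unique_left paired_cores_unique_right)
qed

text \<open>
  Two cores of the same word are equal or paired, so in either case some label has both of them
  as cores, and that label equals \<open>i\<close> as well as \<open>j\<close>.
\<close>

lemma components_disjoint:
  assumes u: "primitive_word u" and ij: "i \<in> labels u" "j \<in> labels u"
    and w: "w \<in> component u i" "w \<in> component u j"
  shows "i = j"
proof -
  have nil: "core u []"
    using u by (auto simp: primitive_word_def intro: core_short)
  have core: "core u s" if "i \<in> labels u" "s \<in> label_cores i" for i s
    using that nil paired_cores_core by (cases i) (auto simp: labels_def free_cores_def)
  obtain s t x y where s: "s \<in> label_cores i" and t: "t \<in> label_cores j"
    and eq: "w = sandwich u s x" "w = sandwich u t y"
    using w unfolding component_label_cores by blast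
  have "s = t \<or> (s, t) \<in> paired_cores u \<or> (t, s) \<in> paired_cores u"
    using cores_of_sandwich_unique[OF u core[OF ij(1) s] core[OF ij(2) t]] eq by metis
  then obtain k where k: "k \<in> labels u" "s \<in> label_cores k" "t \<in> label_cores k"
  proof (elim disjE)
    assume "s = t"
    then show ?thesis using that[of i] ij(1) s by simp
  next
    assume "(s, t) \<in> paired_cores u"
    then show ?thesis using that[of "Paired s t"] by (auto simp: labels_def)
  next
    assume "(t, s) \<in> paired_cores u"
    then show ?thesis using that[of "Paired t s"] by (auto simp: labels_def)
  qed
  then show ?thesis
    using label_of_core_unique[OF u] ij s t by metis
qed


section \<open>Submodules spanned by words\<close>

lemma supported_in_additive_closed:
  fixes f :: "'a \<Rightarrow>\<^sub>0 'b::comm_monoid_add"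
  assumes "0 \<in> M" and "\<And>f g. f \<in> M \<Longrightarrow> g \<in> M \<Longrightarrow> f + g \<in> M"
    and "\<And>w c. w \<in> W \<Longrightarrow> Poly_Mapping.single w c \<in> M"
    and "Poly_Mapping.keys f \<subseteq> W"
  shows "f \<in> M"
proof -
  have "(\<Sum>w\<in>A. Poly_Mapping.single w (Poly_Mapping.lookup f w)) \<in> M"
    if "finite A" "A \<subseteq> W" for A
    using that assms(1-3) by (induction A rule: finite_induct) auto
  moreover have "f = (\<Sum>w\<in>Poly_Mapping.keys f. Poly_Mapping.single w (Poly_Mapping.lookup f w))"
    by (rule poly_mapping_eqI) (simp add: lookup_sum lookup_single when_def in_keys_iff)
  ultimately show ?thesis
    using assms(4) by (metis finite_keys)
qed

lemma single_eq_const_mon: "Poly_Mapping.single w c = const c * mon w"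
  by (simp add: const_def mon_def mult_single plus_list_def)

lemma act_mon_single:
  "act u (Poly_Mapping.single x c) (mon t) = Poly_Mapping.single (sandwich u t x) c"
proof (cases x)
  case (Pair a b)
  then show ?thesis
    by (simp add: act_single sandwich_def single_eq_const_mon mon_append mult.assoc
        flip: mon_word_power)
qed

lemma act_mon_eq_sum:
  "act u p (mon t) =
    (\<Sum>x\<in>Poly_Mapping.keys p. Poly_Mapping.single (sandwich u t x) (Poly_Mapping.lookup p x))"
  unfolding act_def
  by (rule sum.cong) (auto simp: act_mon_single simp flip: act_single)

lemma keys_act_mon: "Poly_Mapping.keys (act u p (mon t)) \<subseteq> sandwich u t ` Poly_Mapping.keys p"
proof -
  have "Poly_Mapping.keys (act u p (mon t)) \<subseteq>
      (\<Union>x\<in>Poly_Mapping.keys p. Poly_Mapping.keys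
        (Poly_Mapping.single (sandwich u t x) (Poly_Mapping.lookup p x)))"
    unfolding act_mon_eq_sum by (rule keys_sum)
  also have "\<dots> \<subseteq> sandwich u t ` Poly_Mapping.keys p"
    by (auto split: if_splits)
  finally show ?thesis .
qed

lemma lookup_act_mon:
  assumes "inj_on (sandwich u t) D" "Poly_Mapping.keys p \<subseteq> D" "x \<in> D"
  shows "Poly_Mapping.lookup (act u p (mon t)) (sandwich u t x) = Poly_Mapping.lookup p x"
proof -
  have "Poly_Mapping.lookup (act u p (mon t)) (sandwich u t x) =
      (\<Sum>y\<in>Poly_Mapping.keys p.
        if sandwich u t y = sandwich u t x then Poly_Mapping.lookup p y else 0)"
    by (simp add: act_mon_eq_sum lookup_sum lookup_single when_def)
  also have "\<dots> = (\<Sum>y\<in>Poly_Mapping.keys p. if y = x then Poly_Mapping.lookup p y else 0)"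
    by (rule sum.cong) (use assms in \<open>auto dest: inj_onD\<close>)
  also have "\<dots> = Poly_Mapping.lookup p x"
    by (simp add: in_keys_iff)
  finally show ?thesis .
qed

lemma cyclic_eq_supported:
  "cyclic u (mon t) = {f :: ('x, 'k::field) free_algebra. Poly_Mapping.keys f \<subseteq> range (sandwich u t)}"
proof -
  interpret module "act u :: 'k poly2 \<Rightarrow> ('x, 'k) free_algebra \<Rightarrow> _" by (rule module_act)
  have "cyclic u (mon t :: ('x, 'k) free_algebra) = range (\<lambda>p. act u p (mon t))"
    by (rule span_singleton)
  moreover have "f \<in> cyclic u (mon t)"
    if "Poly_Mapping.keys f \<subseteq> range (sandwich u t)" for f :: "('x, 'k) free_algebra"
  proof (rule supported_in_additive_closed[OF _ _ _ that])
    fix w and c :: 'k assume "w \<in> range (sandwich u t)"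
    then show "Poly_Mapping.single w c \<in> cyclic u (mon t)"
      by (auto simp: span_singleton simp flip: act_mon_single)
  qed (auto intro: span_zero span_add)
  ultimately show ?thesis
    using keys_act_mon by fastforce
qed

lemma powers_eq_supported:
  "generated_subalgebra (mon u) =
    {f :: ('x, 'k::field) free_algebra. Poly_Mapping.keys f \<subseteq> range (sandwich u [])}"
    (is "_ = ?R")
proof
  have powers: "range (sandwich u []) = range (word_power u)"
  proof (safe)
    fix a b show "sandwich u [] (a, b) \<in> range (word_power u)"
      by (auto simp: sandwich_def simp flip: word_power_add)
  next
    fix n show "word_power u n \<in> range (sandwich u [])"
      by (rule range_eqI[of _ _ "(n, 0)"]) (simp add: sandwich_def)
  qed
  have mult: "f * g \<in> ?R" if "f \<in> ?R" "g \<in> ?R" for f g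
  proof -
    have "Poly_Mapping.keys (f * g) \<subseteq> {a + b | a b. a \<in> Poly_Mapping.keys f \<and> b \<in> Poly_Mapping.keys g}"
      by (rule keys_mult)
    also have "\<dots> \<subseteq> range (word_power u)"
      using that unfolding powers by (force simp: plus_list_def simp flip: word_power_add)
    finally show ?thesis unfolding powers by simp
  qed
  have word: "mon (word_power u n) \<in> ?R" for n
    unfolding powers mon_def by (auto split: if_splits)
  have const: "const c \<in> ?R" for c
  proof -
    have "[] \<in> range (word_power u)" by (rule range_eqI[of _ _ 0]) simp
    then show ?thesis unfolding powers const_def by auto
  qed
  have add: "f + g \<in> ?R" if "f \<in> ?R" "g \<in> ?R" for f g
    using that keys_add[of f g] by blast
  have "subalgebra ?R"
    unfolding subalgebra_def
  proof (intro conjI allI ballI add mult const)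
    show "1 \<in> ?R" using word[of 0] unfolding word_power_0 mon_Nil .
  qed
  moreover have "mon u \<in> ?R"
    using word[of 1] by (simp add: word_power_Suc)
  ultimately show "generated_subalgebra (mon u) \<subseteq> ?R"
    by (intro hull_minimal) auto
  show "?R \<subseteq> generated_subalgebra (mon u)"
  proof
    fix f :: "('x, 'k) free_algebra" assume "f \<in> ?R"
    then have f: "Poly_Mapping.keys f \<subseteq> range (word_power u)" using powers by auto
    have "f \<in> A" if A: "subalgebra A" "mon u \<in> A" for A
    proof (rule supported_in_additive_closed[OF _ _ _ f])
      have "const 0 * 1 \<in> A" using A(1) unfolding subalgebra_def by blast
      then show "0 \<in> A" by (simp add: const_def)
      fix w and c :: 'k assume "w \<in> range (word_power u)"
      then obtain n where w: "w = word_power u n" by blast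
      have "mon u ^ n \<in> A" by (induction n) (use A in \<open>auto simp: subalgebra_def\<close>)
      then show "Poly_Mapping.single w c \<in> A"
        using A(1) by (simp add: w single_eq_const_mon mon_word_power subalgebra_def)
    qed (use A(1) in \<open>auto simp: subalgebra_def\<close>)
    then show "f \<in> generated_subalgebra (mon u)"
      by (auto simp: hull_def)
  qed
qed

definition restrict_keys :: "'a set \<Rightarrow> ('a \<Rightarrow>\<^sub>0 'b::comm_monoid_add) \<Rightarrow> 'a \<Rightarrow>\<^sub>0 'b" where
  "restrict_keys W f =
    (\<Sum>w\<in>Poly_Mapping.keys f \<inter> W. Poly_Mapping.single w (Poly_Mapping.lookup f w))"

lemma lookup_restrict_keys:
  "Poly_Mapping.lookup (restrict_keys W f) w = (if w \<in> W then Poly_Mapping.lookup f w else 0)"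
  by (simp add: restrict_keys_def lookup_sum lookup_single when_def in_keys_iff)

lemma keys_restrict_keys: "Poly_Mapping.keys (restrict_keys W f) = Poly_Mapping.keys f \<inter> W"
  by (auto simp: in_keys_iff lookup_restrict_keys split: if_splits)

lemma supported_Un:
  "{f + g | f g. Poly_Mapping.keys f \<subseteq> V \<and> Poly_Mapping.keys g \<subseteq> W} =
    {f :: 'a \<Rightarrow>\<^sub>0 'b::comm_monoid_add. Poly_Mapping.keys f \<subseteq> V \<union> W}"
proof (intro equalityI subsetI)
  fix f :: "'a \<Rightarrow>\<^sub>0 'b" assume "f \<in> {f. Poly_Mapping.keys f \<subseteq> V \<union> W}"
  then have f: "Poly_Mapping.keys f \<subseteq> V \<union> W" by simp
  have "f = restrict_keys V f + restrict_keys (- V) f"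
    by (rule poly_mapping_eqI) (simp add: lookup_add lookup_restrict_keys)
  moreover have "Poly_Mapping.keys (restrict_keys V f) \<subseteq> V"
    "Poly_Mapping.keys (restrict_keys (- V) f) \<subseteq> W"
    using f by (auto simp: keys_restrict_keys)
  ultimately show "f \<in> {f + g | f g. Poly_Mapping.keys f \<subseteq> V \<and> Poly_Mapping.keys g \<subseteq> W}"
    by blast
qed (use Poly_Mapping.keys_add in fastforce)

lemma summand_eq_supported:
  "summand u i = {f :: ('x, 'k::field) free_algebra. Poly_Mapping.keys f \<subseteq> component u i}"
  by (cases i) (simp_all add: powers_eq_supported cyclic_eq_supported supported_Un)

lemma summand_subspace:
  "module.subspace (act u :: 'k::field poly2 \<Rightarrow> ('x, 'k) free_algebra \<Rightarrow> _) (summand u i)"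
proof -
  interpret module "act u :: 'k poly2 \<Rightarrow> ('x, 'k) free_algebra \<Rightarrow> _" by (rule module_act)
  have "summand u Powers = cyclic u (mon [] :: ('x, 'k) free_algebra)"
    by (simp add: powers_eq_supported cyclic_eq_supported)
  moreover have "summand u (Paired t1 t2) =
      span ({mon t1} \<union> {mon t2 :: ('x, 'k) free_algebra})" for t1 t2
    unfolding span_Un by simp
  ultimately show ?thesis
    by (cases i) (simp_all only: summand.simps(2) subspace_span)
qed

text \<open>
  The only candidate for the component of \<open>v\<close> in \<open>M i\<close> is the restriction of \<open>v\<close> to \<open>C i\<close>. As \<open>v\<close> has
  finitely many keys, each in one class, almost all of these restrictions vanish.
\<close>

lemma is_direct_sum_partition:
  fixes M :: "'i \<Rightarrow> ('a \<Rightarrow>\<^sub>0 'b::ab_group_add) set"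
  assumes sub: "\<And>i. i \<in> I \<Longrightarrow> module.subspace scale (M i)"
    and M: "\<And>i. i \<in> I \<Longrightarrow> M i = {f. Poly_Mapping.keys f \<subseteq> C i}"
    and cover: "\<And>w. \<exists>i\<in>I. w \<in> C i"
    and disj: "\<And>i j w. i \<in> I \<Longrightarrow> j \<in> I \<Longrightarrow> w \<in> C i \<Longrightarrow> w \<in> C j \<Longrightarrow> i = j"
  shows "is_direct_sum scale I M"
proof -
  let ?ok = "\<lambda>v f. (\<forall>i. i \<notin> I \<longrightarrow> f i = 0) \<and> (\<forall>i\<in>I. f i \<in> M i) \<and>
               finite {i. f i \<noteq> 0} \<and> v = (\<Sum>i | f i \<noteq> 0. f i)"
  have "\<exists>!f. ?ok v f" for v
  proof
    let ?g = "\<lambda>i. if i \<in> I then restrict_keys (C i) v else 0"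
    have lookup_sum_family:
      "Poly_Mapping.lookup (\<Sum>i | f i \<noteq> 0. f i) w = Poly_Mapping.lookup (f j) w"
      if f: "\<forall>i\<in>I. f i \<in> M i" "\<forall>i. i \<notin> I \<longrightarrow> f i = 0" "finite {i. f i \<noteq> 0}"
        and j: "j \<in> I" "w \<in> C j" for f w j
    proof -
      have "Poly_Mapping.lookup (f i) w = 0" if "i \<noteq> j" for i
      proof (cases "i \<in> I")
        case True
        then have "w \<notin> C i" using disj[OF True j(1) _ j(2)] that by blast
        moreover have "Poly_Mapping.keys (f i) \<subseteq> C i" using f(1) M[OF True] True by blast
        ultimately show ?thesis by (auto simp: in_keys_iff)
      qed (use f(2) in simp)
      then have "(\<Sum>i | f i \<noteq> 0. Poly_Mapping.lookup (f i) w) =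
          (\<Sum>i | f i \<noteq> 0. if i = j then Poly_Mapping.lookup (f j) w else 0)"
        by (intro sum.cong) auto
      then show ?thesis
        using f(3) by (simp add: lookup_sum)
    qed
    show ok: "?ok v ?g"
    proof (intro conjI)
      \<comment> \<open>A class with a nonzero restriction is the class of some key of \<open>v\<close>.\<close>
      have "{i. ?g i \<noteq> 0} \<subseteq> (\<lambda>w. THE i. i \<in> I \<and> w \<in> C i) ` Poly_Mapping.keys v"
      proof
        fix i assume "i \<in> {i. ?g i \<noteq> 0}"
        then have i: "i \<in> I" "Poly_Mapping.keys (restrict_keys (C i) v) \<noteq> {}"
          by (auto split: if_splits)
        then obtain w where w: "w \<in> Poly_Mapping.keys v" "w \<in> C i"
          by (auto simp: keys_restrict_keys)
        then have "(THE i. i \<in> I \<and> w \<in> C i) = i"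
          using i(1) disj by blast
        with w(1) show "i \<in> (\<lambda>w. THE i. i \<in> I \<and> w \<in> C i) ` Poly_Mapping.keys v"
          by blast
      qed
      then show fin: "finite {i. ?g i \<noteq> 0}"
        by (rule finite_subset) simp
      show mem: "\<forall>i\<in>I. ?g i \<in> M i"
        using M by (auto simp: keys_restrict_keys)
      show "v = (\<Sum>i | ?g i \<noteq> 0. ?g i)"
      proof (rule poly_mapping_eqI)
        fix w
        obtain j where "j \<in> I" "w \<in> C j" using cover by blast
        then show "Poly_Mapping.lookup v w = Poly_Mapping.lookup (\<Sum>i | ?g i \<noteq> 0. ?g i) w"
          using lookup_sum_family[of ?g j w] mem fin by (simp add: lookup_restrict_keys)
      qed
    qed simp
    fix f assume f: "?ok v f"
    show "f = ?g"
    proof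
      fix j
      show "f j = ?g j"
      proof (cases "j \<in> I")
        case True
        have "Poly_Mapping.lookup (f j) w = Poly_Mapping.lookup (restrict_keys (C j) v) w" for w
        proof (cases "w \<in> C j")
          case in_C: True
          then show ?thesis
            using f lookup_sum_family[of f j w] True by (simp add: lookup_restrict_keys)
        next
          case False
          have "Poly_Mapping.keys (f j) \<subseteq> C j" using f M[OF True] True by blast
          with False show ?thesis by (auto simp: lookup_restrict_keys in_keys_iff)
        qed
        with True show ?thesis by (simp add: poly_mapping_eqI)
      qed (use f in simp)
    qed
  qed
  with sub show ?thesis by (simp add: is_direct_sum_def)
qed


section \<open>Relations between the generators\<close>

lemma act_mon_eq_0:
  fixes p :: "'k::field poly2"
  assumes "inj_on (sandwich u t) D" "Poly_Mapping.keys p \<subseteq> D" "act u p (mon t) = 0"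
  shows "p = 0"
proof (rule poly_mapping_eqI)
  fix x
  show "Poly_Mapping.lookup p x = Poly_Mapping.lookup 0 x"
    using lookup_act_mon[OF assms(1,2)] assms(2,3)
    by (cases "x \<in> D") (auto simp: in_keys_iff)
qed

lemma free_generator:
  assumes "inj (sandwich u t)"
  shows "\<not> module.dependent (act u) {mon t :: ('x, 'k::field) free_algebra}"
proof -
  interpret module "act u :: 'k poly2 \<Rightarrow> ('x, 'k) free_algebra \<Rightarrow> _" by (rule module_act)
  show ?thesis
    using act_mon_eq_0[OF assms] by (auto simp: dependent_finite)
qed

lemma U1_power: "U1 ^ n = Poly_Mapping.single (n, 0) (1 :: 'k::field)"
  by (induction n) (simp_all add: U1_def mult_single flip: zero_prod_def)

text \<open>
  Modulo \<open>u\<^sub>1 - u\<^sub>2\<close> every polynomial is congruent to one in \<open>u\<^sub>1\<close> alone, and the powers of \<open>u\<close>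
  are linearly independent.
\<close>

lemma powers_defining_relation:
  assumes "u \<noteq> []"
  shows "defining_relation1 (act u) (1 :: ('x, 'k::field) free_algebra) (U1 - U2)"
proof -
  interpret module "act u :: 'k poly2 \<Rightarrow> ('x, 'k) free_algebra \<Rightarrow> _" by (rule module_act)
  interpret R: module "times :: 'k poly2 \<Rightarrow> _" by (rule module_mult_self)
  let ?D = "range (\<lambda>n::nat. (n, 0::nat))"
  have step: "\<exists>q. Poly_Mapping.keys q \<subseteq> ?D \<and> p - q \<in> R.span {U1 - U2}" for p
  proof (induction p rule: poly_mapping_single_sum_induct)
    case (single x c)
    obtain a b where x: "x = (a, b)" by force
    have "Poly_Mapping.single (a, b) c - Poly_Mapping.single (a + b, 0) c \<in> R.span {U1 - U2}" for a
    proof (induction b arbitrary: a)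
      case 0
      then show ?case by (simp add: R.span_zero)
    next
      case (Suc b)
      have "- Poly_Mapping.single (a, b) c * (U1 - U2) \<in> R.span {U1 - U2}"
        by (intro R.span_scale R.span_base) simp
      from R.span_add[OF this Suc[of "Suc a"]] show ?case
        by (simp add: U1_def U2_def mult_single algebra_simps)
    qed
    then show ?case
      unfolding x by (intro exI[of _ "Poly_Mapping.single (a + b, 0) c"]) auto
  next
    case (sum p p')
    then obtain q q' where q: "Poly_Mapping.keys q \<subseteq> ?D" "p - q \<in> R.span {U1 - U2}"
      "Poly_Mapping.keys q' \<subseteq> ?D" "p' - q' \<in> R.span {U1 - U2}" by blast
    have "p + p' - (q + q') \<in> R.span {U1 - U2}"
      using R.span_add[OF q(2,4)] by (simp add: algebra_simps)
    moreover have "Poly_Mapping.keys (q + q') \<subseteq> ?D"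
      using q(1,3) Poly_Mapping.keys_add[of q q'] by blast
    ultimately show ?case by blast
  qed
  have rel: "act u p 1 = 0" if "p \<in> R.span {U1 - U2}" for p
    using that by (auto simp: R.span_singleton act_mult scale_left_diff_distrib act_U1 act_U2)
  have "p \<in> R.span {U1 - U2}" if p: "act u p (1 :: ('x, 'k) free_algebra) = 0" for p
  proof -
    obtain q where q: "Poly_Mapping.keys q \<subseteq> ?D" "p - q \<in> R.span {U1 - U2}"
      using step by blast
    have "act u q (mon [] :: ('x, 'k) free_algebra) = 0"
      using rel[OF q(2)] p by (simp add: scale_left_diff_distrib mon_Nil)
    moreover have "inj_on (sandwich u []) ?D"
    proof (rule inj_onI, clarify)
      fix m n assume "sandwich u [] (m, 0) = sandwich u [] (n, 0)"
      from arg_cong[OF this, of length] show "m = n \<and> 0 = 0"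
        using assms by (simp add: sandwich_def)
    qed
    ultimately have "q = 0" using act_mon_eq_0[OF _ q(1)] by blast
    with q(2) show ?thesis by simp
  qed
  with rel show ?thesis by (auto simp: defining_relation1_def)
qed

text \<open>
  The relation \<open>u\<^sub>2 t\<^sub>1 = u\<^sub>1 t\<^sub>2\<close> turns every term \<open>u\<^sub>1\<^sup>a u\<^sub>2\<^sup>b t\<^sub>1\<close> with \<open>b > 0\<close> into a multiple of \<open>t\<^sub>2\<close>.
  What remains is a combination of the words \<open>u\<^sup>a t\<^sub>1\<close> and \<open>u\<^sup>a t\<^sub>2 u\<^sup>b\<close>, which are pairwise
  distinct: by \<open>sandwich_core_eq\<close>, a coincidence between the two kinds would need a factor \<open>u\<close> to the
  right of \<open>t\<^sub>1\<close>.
\<close>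

lemma paired_defining_relation:
  assumes u: "primitive_word u" and t: "(t1, t2) \<in> paired_cores u"
  shows "defining_relation2 (act u) (mon t1 :: ('x, 'k::field) free_algebra) (mon t2) (U2, - U1)"
proof -
  interpret module "act u :: 'k poly2 \<Rightarrow> ('x, 'k) free_algebra \<Rightarrow> _" by (rule module_act)
  interpret R: module "scale2 :: 'k poly2 \<Rightarrow> _" by (rule module_scale2)
  let ?D = "range (\<lambda>n::nat. (n, 0::nat))"
  let ?r = "(U2, - U1) :: 'k poly2 \<times> 'k poly2"
  have step: "\<exists>p' q'. Poly_Mapping.keys p' \<subseteq> ?D \<and> (p, 0) - (p', q') \<in> R.span {?r}" for p
  proof (induction p rule: poly_mapping_single_sum_induct)
    case (single x c)
    obtain a b where x: "x = (a, b)" by force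
    show ?case
    proof (cases b)
      case 0
      then show ?thesis
        unfolding x
        by (intro exI[of _ "Poly_Mapping.single (a, 0) c"] exI[of _ 0])
          (auto simp: R.span_zero simp flip: zero_prod_def)
    next
      case (Suc b')
      have "(Poly_Mapping.single x c, 0) - (0, Poly_Mapping.single (Suc a, b') c) =
          scale2 (Poly_Mapping.single (a, b') c) ?r"
        by (simp add: x Suc scale2_def U1_def U2_def mult_single)
      moreover have "scale2 (Poly_Mapping.single (a, b') c) ?r \<in> R.span {?r}"
        by (intro R.span_scale R.span_base) simp
      ultimately show ?thesis
        by (intro exI[of _ 0] exI[of _ "Poly_Mapping.single (Suc a, b') c"]) simp
    qed
  next
    case (sum p1 p2)
    then obtain q1 q2 r1 r2 where q: "Poly_Mapping.keys q1 \<subseteq> ?D" "(p1, 0) - (q1, r1) \<in> R.span {?r}"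
      "Poly_Mapping.keys q2 \<subseteq> ?D" "(p2, 0) - (q2, r2) \<in> R.span {?r}" by blast
    have "(p1 + p2, 0) - (q1 + q2, r1 + r2) \<in> R.span {?r}"
      using R.span_add[OF q(2,4)] by (simp add: algebra_simps)
    moreover have "Poly_Mapping.keys (q1 + q2) \<subseteq> ?D"
      using q(1,3) Poly_Mapping.keys_add[of q1 q2] by blast
    ultimately show ?case by blast
  qed
  have "mon t1 * mon u = (mon u * mon t2 :: ('x, 'k) free_algebra)"
    unfolding mon_append[symmetric] paired_coresD(3)[OF t] ..
  then have rel: "act u p (mon t1) + act u q (mon t2 :: ('x, 'k) free_algebra) = 0"
    if "(p, q) \<in> R.span {?r}" for p q
    using that
    by (auto simp: R.span_singleton scale2_def act_mult act_U1 act_U2)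
  note cores = paired_cores_core[OF t]
  note nonempty = paired_coresD(1,5)[OF t]
  have "(p, q) \<in> R.span {?r}"
    if pq: "act u p (mon t1) + act u q (mon t2 :: ('x, 'k) free_algebra) = 0" for p q
  proof -
    obtain p' q0 where p': "Poly_Mapping.keys p' \<subseteq> ?D" "(p, 0) - (p', q0) \<in> R.span {?r}"
      using step by blast
    \<comment> \<open>The reduction of \<open>(p, 0)\<close> puts \<open>q0\<close> into the second coordinate, on top of \<open>q\<close>.\<close>
    define q' where "q' = q + q0"
    have red: "(p - p', q - q') \<in> R.span {?r}"
      using p'(2) by (simp add: q'_def)
    have "act u p' (mon t1) + act u q' (mon t2 :: ('x, 'k) free_algebra) =
        (act u p (mon t1) + act u q (mon t2)) - (act u (p - p') (mon t1) + act u (q - q') (mon t2))"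
      unfolding scale_left_diff_distrib by simp
    then have sum0: "act u p' (mon t1) + act u q' (mon t2 :: ('x, 'k) free_algebra) = 0"
      unfolding rel[OF red] pq by simp
    \<comment> \<open>The words \<open>u\<^sup>a t\<^sub>1\<close> do not occur in the second term, so their coefficients vanish separately.\<close>
    have "p' = 0"
    proof (rule poly_mapping_eqI)
      fix x
      show "Poly_Mapping.lookup p' x = Poly_Mapping.lookup 0 x"
      proof (cases "x \<in> ?D")
        case True
        have "sandwich u t1 x \<noteq> sandwich u t2 (c, d)" for c d
        proof
          obtain a where x: "x = (a, 0)" using True by blast
          assume eq: "sandwich u t1 x = sandwich u t2 (c, d)"
          have "t1 \<noteq> t2" "(t2, t1) \<notin> paired_cores u"
            using paired_cores_no_chain[OF u] t by blast+
          then show False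
            using sandwich_core_eq[OF u cores eq[unfolded x]]
              sandwich_core_eq[OF u cores(2,1) eq[unfolded x, symmetric]] nonempty
            by (cases "a \<le> c") auto
        qed
        then have "sandwich u t1 x \<notin> Poly_Mapping.keys (act u q' (mon t2 :: ('x, 'k) free_algebra))"
          using keys_act_mon[of u q' t2] by fastforce
        moreover have "Poly_Mapping.lookup (act u p' (mon t1)) (sandwich u t1 x) = Poly_Mapping.lookup p' x"
          using sandwich_inj[OF u cores(1) nonempty(1)] by (intro lookup_act_mon[of u t1 UNIV]) auto
        moreover have "Poly_Mapping.lookup (act u p' (mon t1) + act u q' (mon t2 :: ('x, 'k) free_algebra))
            (sandwich u t1 x) = 0"
          using sum0 by simp
        ultimately show ?thesis
          by (simp add: lookup_add in_keys_iff)
      qed (use p'(1) in \<open>auto simp: in_keys_iff\<close>)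
    qed
    moreover from this have "q' = 0"
      using sum0 act_mon_eq_0[OF sandwich_inj[OF u cores(2) nonempty(2)], of q'] by simp
    ultimately show ?thesis using red by simp
  qed
  with rel show ?thesis by (auto simp: defining_relation2_def)
qed


section \<open>The decomposition\<close>

lemma paired_cores_shape:
  assumes u: "primitive_word u" and t: "(t1, t2) \<in> paired_cores u"
  shows "strict_prefix t1 u" "strict_suffix t2 u"
    "\<exists>v1 v2 k. v1 @ v2 \<noteq> v2 @ v1 \<and> k > 0 \<and>
          u = word_power (v1 @ v2) k @ v1 \<and> t1 = v1 @ v2 \<and> t2 = v2 @ v1"
proof -
  have t': "t1 \<noteq> []" "length t1 < length u" "t1 @ u = u @ t2" "length t2 < length u"
    using paired_coresD[OF t] by simp_all
  obtain z where "t1 = u @ z \<or> u = t1 @ z \<and> u = z @ t2"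
    using iffD1[OF append_eq_append_conv2 t'(3)] by blast
  moreover have "t1 \<noteq> u @ z" using t'(2) by auto
  ultimately have z: "u = t1 @ z" "u = z @ t2" by blast+
  show "strict_prefix t1 u"
    using z(1) t'(2) by (auto simp: strict_prefix_def)
  show "strict_suffix t2 u"
    using z(2) t'(4) by (auto simp: strict_suffix_def suffix_def)
  obtain v1 v2 k where v: "u = word_power (v1 @ v2) k @ v1" "t1 = v1 @ v2" "t2 = v2 @ v1"
    using conjugate_words[OF t'(3,1)] by blast
  have "v1 @ v2 \<noteq> v2 @ v1"
    using paired_cores_no_chain[OF u t] t v(2,3) by metis
  moreover have "k > 0"
    using t'(2) v(1,2) by (cases k) auto
  ultimately show "\<exists>v1 v2 k. v1 @ v2 \<noteq> v2 @ v1 \<and> k > 0 \<and>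
          u = word_power (v1 @ v2) k @ v1 \<and> t1 = v1 @ v2 \<and> t2 = v2 @ v1"
    using v by blast
qed

theorem theorem2p1:
  fixes u :: "'x::finite list"
  assumes "length u > 0"
    and "\<not> (\<exists>w k. k \<ge> 2 \<and> u = word_power w k)"
  defines "A \<equiv> (act u :: 'k::field_char_0 poly2 \<Rightarrow> ('x, 'k) free_algebra \<Rightarrow> ('x, 'k) free_algebra)"
  shows "\<exists>(T :: 'x list set) (P :: ('x list \<times> 'x list) set).
    is_direct_sum A ({Powers} \<union> Free ` T \<union> {Paired t1 t2 | t1 t2. (t1, t2) \<in> P}) (summand u) \<and>
    (generated_subalgebra (mon u) = module.span A {1} \<and>
     (\<forall>p. mon u ^ p = A (U1 ^ p) 1) \<and>
     defining_relation1 A 1 (U1 - U2)) \<and>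
    (\<forall>t\<in>T.
       \<not> module.dependent A {mon t} \<and>
       \<not> prefix u t \<and> \<not> suffix u t \<and>
       (\<forall>t'. prefix t u \<and> suffix t' u \<and> length t' = length t \<longrightarrow> t @ u \<noteq> u @ t') \<and>
       (\<forall>t'. suffix t u \<and> prefix t' u \<and> length t' = length t \<longrightarrow> u @ t \<noteq> t' @ u)) \<and>
    (\<forall>(t1, t2)\<in>P.
       length t1 = length t2 \<and> strict_prefix t1 u \<and> strict_suffix t2 u \<and> t1 @ u = u @ t2 \<and>
       defining_relation2 A (mon t1) (mon t2) (U2, - U1) \<and>
       (\<exists>v1 v2 k. v1 @ v2 \<noteq> v2 @ v1 \<and> k > 0 \<and>
          u = word_power (v1 @ v2) k @ v1 \<and> t1 = v1 @ v2 \<and> t2 = v2 @ v1))"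
proof (intro exI[of _ "free_cores u"] exI[of _ "paired_cores u"] conjI ballI allI impI)
  have u: "primitive_word u" and nonempty: "u \<noteq> []"
    using assms(1,2) by (auto simp: primitive_word_def)
  show "is_direct_sum A ({Powers} \<union> Free ` free_cores u \<union>
      {Paired t1 t2 | t1 t2. (t1, t2) \<in> paired_cores u}) (summand u)"
    unfolding A_def labels_def[symmetric]
    by (rule is_direct_sum_partition[OF summand_subspace summand_eq_supported
          components_cover[OF nonempty] components_disjoint[OF u]])
  show "generated_subalgebra (mon u) = module.span A {1}"
    unfolding A_def powers_eq_supported mon_Nil[symmetric] cyclic_eq_supported ..
  show "mon u ^ p = A (U1 ^ p) 1" for p
    unfolding A_def U1_power act_single by (simp add: const_def flip: zero_list_def)
  show "defining_relation1 A 1 (U1 - U2)"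
    unfolding A_def by (rule powers_defining_relation[OF nonempty])
  {
    fix t assume t: "t \<in> free_cores u"
    then have core: "core u t" by (simp add: free_cores_def)
    show "\<not> module.dependent A {mon t}"
      unfolding A_def
      by (intro free_generator sandwich_inj[OF u core]) (rule free_cores_not_paired[OF t])
    show "\<not> prefix u t" "\<not> suffix u t" using core by (auto simp: core_def)
    show "t @ u \<noteq> u @ t'" "u @ t \<noteq> t' @ u" for t'
      using t by (auto simp: free_cores_def)
  }
  {
    fix x assume "x \<in> paired_cores u"
    then obtain t1 t2 where x: "x = (t1, t2)" and t: "(t1, t2) \<in> paired_cores u"
      by (cases x) auto
    then show "case x of (t1, t2) \<Rightarrow>
       length t1 = length t2 \<and> strict_prefix t1 u \<and> strict_suffix t2 u \<and> t1 @ u = u @ t2 \<and>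
       defining_relation2 A (mon t1) (mon t2) (U2, - U1) \<and>
       (\<exists>v1 v2 k. v1 @ v2 \<noteq> v2 @ v1 \<and> k > 0 \<and>
          u = word_power (v1 @ v2) k @ v1 \<and> t1 = v1 @ v2 \<and> t2 = v2 @ v1)"
      unfolding x A_def prod.case
      by (intro conjI paired_coresD(3,4)[OF t] paired_cores_shape[OF u t]
          paired_defining_relation[OF u t])
  }
qed

end
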